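(* For every $d\in\mathbb{N}$ there exist constants $0<c\le C<\infty$ depending only on $d$ such that for every integer $n\ge d$ and each real array $A=(a_{i_1,\dots,i_d})_{1\le i_1<i_2<\dots<i_d\le n}$, $$ c\,\|A\|_{cut}^*\le\Bigl\|\sum_{1\le i_1<i_2<\dots<i_d\le n}a_{i_1,i_2,\dots,i_d}\,r_{i_1}r_{i_2}\cdots r_{i_d}\Bigr\|_{L_\infty([0,1])}\le C\,\|A\|_{cut}^*. $$
   Context: The Rademacher functions are $r_i(t)=(-1)^{[2^i t]}$, $t\in[0,1]$, $i=1,2,\dots$, where $[x]$ is the integer part of $x$; $r_{i_1}\cdots r_{i_d}$ is the pointwise product on $[0,1]$. The modified cut-norm is $$\|A\|_{cut}^*:=\max\Bigl\{\Bigl|\sum_{i_1<i_2<\dots<i_d,\ i_1,\dots,i_d\in I}a_{i_1,\dots,i_d}\Bigr|:\ I\subset\{1,\dots,n\}\Bigr\}.$$ *)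

theory Defs
  imports "HOL-Analysis.Analysis" "HOL-Probability.Essential_Supremum"
begin

text \<open>The indices \<open>i\<^sub>1 < \<dots> < i\<^sub>d\<close> with values in \<open>I\<close>, as strictly increasing lists.
  A \<open>d\<close>-dimensional array is a function on such lists; its values elsewhere are never used.\<close>

definition incr_tuples :: "nat \<Rightarrow> nat set \<Rightarrow> nat list set" where
  "incr_tuples d I = {is. length is = d \<and> sorted_wrt (<) is \<and> set is \<subseteq> I}"

definition rademacher :: "nat \<Rightarrow> real \<Rightarrow> real" where
  "rademacher i t = (-1) powi \<lfloor>2 ^ i * t\<rfloor>"

definition rademacher_chaos :: "nat \<Rightarrow> nat \<Rightarrow> (nat list \<Rightarrow> real) \<Rightarrow> real \<Rightarrow> real" where
  "rademacher_chaos d n a t =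
    (\<Sum>is\<in>incr_tuples d {1..n}. a is * (\<Prod>i\<leftarrow>is. rademacher i t))"

definition cut_norm_star :: "nat \<Rightarrow> nat \<Rightarrow> (nat list \<Rightarrow> real) \<Rightarrow> real" where
  "cut_norm_star d n a = Max {\<bar>\<Sum>is\<in>incr_tuples d I. a is\<bar> | I. I \<subseteq> {1..n}}"

text \<open>Extended-real valued because \<open>esssup\<close> needs a complete linear order.\<close>

definition Linfty_norm :: "(real \<Rightarrow> real) \<Rightarrow> ereal" where
  "Linfty_norm f = esssup (lebesgue_on {0..1}) (\<lambda>t. ereal \<bar>f t\<bar>)"

end

theory Submission
  imports Defs "HOL-Computational_Algebra.Polynomial"
begin

text \<open>
  Write \<open>P x\<close> for the homogeneous polynomial \<open>\<Sum> a\<^bsub>i\<^sub>1\<dots>i\<^sub>d\<^esub> x\<^bsub>i\<^sub>1\<^esub> \<dots> x\<^bsub>i\<^sub>d\<^esub>\<close>. The first \<open>n\<close> Rademacher functions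
  take every sign pattern on a dyadic interval of length \<open>2\<^sup>-\<^sup>n\<close>, so the \<open>L\<^sub>\<infinity>\<close> norm of the chaos is
  the maximum of \<open>\<bar>P\<bar>\<close> over the cube \<open>{-1,1}\<^sup>n\<close> (\<open>sign_pattern_interval\<close>, \<open>abs_form_le_Linfty_norm\<close>).
  The modified cut norm is the maximum of \<open>\<bar>P\<bar>\<close> over \<open>{0,1}\<^sup>n\<close>. The two are compared by the fact
  that \<open>P\<close> is affine in each variable, so that \<open>\<bar>P\<bar>\<close> is largest on a solid box at a vertex
  (\<open>affine_in_each_le_vertex\<close>).

  As \<open>{0,1}\<^sup>n\<close> lies in the solid cube \<open>[-1,1]\<^sup>n\<close>, this gives the lower bound with \<open>c = 1\<close>.
  For the upper bound, fix signs \<open>\<epsilon>\<close> and put \<open>s\<close> in place of each coordinate \<open>-1\<close>. The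
  result is a polynomial \<open>q\<close> in \<open>s\<close> of degree at most \<open>d\<close> with \<open>q (-1) = P \<epsilon>\<close>. At \<open>s = 0, \<dots>, d\<close> the
  point where \<open>P\<close> is evaluated lies in \<open>[0, d + 1]\<^sup>n\<close>, whence \<open>\<bar>q s\<bar>\<close> is at most
  \<open>(d + 1)\<^sup>d\<close> times the cut norm by homogeneity (\<open>abs_form_le_cut_norm_star\<close>). Extrapolating from
  these \<open>d + 1\<close> points to \<open>-1\<close> costs only a factor depending on \<open>d\<close> (\<open>poly_extrapolate_minus_one\<close>).
\<close>

section \<open>Extrapolation of polynomials\<close>

lemma degree_forward_difference_le:
  fixes p :: "real poly"
  assumes "degree p \<le> Suc d"
  shows "degree (pcompose p [:1, 1:] - p) \<le> d"
proof -
  let ?r = "pcompose p [:1, 1:]"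
  have deg: "degree ?r = degree p"
    by (simp add: degree_pcompose)
  have lead: "lead_coeff ?r = lead_coeff p"
    by (subst lead_coeff_comp) auto
  have "coeff (?r - p) i = 0" if "i > d" for i
  proof (cases "i = degree p")
    case True
    then show ?thesis using deg lead by simp
  next
    case False
    with that assms have "degree p < i" by linarith
    then show ?thesis by (simp add: coeff_eq_0 deg)
  qed
  then show ?thesis by (simp add: degree_le)
qed

text \<open>Induction on the degree: the forward difference of \<open>p\<close> has smaller degree, is at most \<open>2 * K\<close>
  at one point fewer, and gives back \<open>p (-1)\<close> from \<open>p 0\<close>.\<close>

lemma poly_extrapolate_minus_one:
  fixes p :: "real poly"
  assumes "degree p \<le> d" and "\<And>k. k \<le> d \<Longrightarrow> \<bar>poly p (real k)\<bar> \<le> K"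
  shows "\<bar>poly p (-1)\<bar> \<le> (2 ^ Suc d - 1) * K"
  using assms
proof (induction d arbitrary: p K)
  case 0
  then obtain c where "p = [:c:]"
    by (auto elim: degree_eq_zeroE)
  then show ?case using "0.prems"(2)[of 0] by simp
next
  case (Suc d)
  let ?q = "pcompose p [:1, 1:] - p"
  have "\<bar>poly ?q (real k)\<bar> \<le> 2 * K" if "k \<le> d" for k
    using Suc.prems(2)[of k] Suc.prems(2)[of "Suc k"] that by (simp add: poly_pcompose)
  then have "\<bar>poly ?q (-1)\<bar> \<le> (2 ^ Suc d - 1) * (2 * K)"
    by (rule Suc.IH[OF degree_forward_difference_le[OF Suc.prems(1)]])
  moreover have "\<bar>poly p 0\<bar> \<le> K"
    using Suc.prems(2)[of 0] by simp
  ultimately have "\<bar>poly p (-1)\<bar> \<le> K + (2 ^ Suc d - 1) * (2 * K)"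
    by (simp add: poly_pcompose)
  then show ?case by (simp add: algebra_simps)
qed

section \<open>Functions that are affine in each variable\<close>

definition affine_in_each :: "(('i \<Rightarrow> real) \<Rightarrow> real) \<Rightarrow> bool" where
  "affine_in_each F \<longleftrightarrow> (\<forall>x i. \<exists>\<alpha> \<beta>. \<forall>t. F (x(i := t)) = \<alpha> + \<beta> * t)"

lemma affine_in_each_sum:
  assumes "\<And>j. j \<in> A \<Longrightarrow> affine_in_each (F j)"
  shows "affine_in_each (\<lambda>x. \<Sum>j\<in>A. c j * F j x)"
  unfolding affine_in_each_def
proof (intro allI)
  fix x :: "'b \<Rightarrow> real" and i
  have "\<forall>j\<in>A. \<exists>\<alpha> \<beta>. \<forall>t. F j (x(i := t)) = \<alpha> + \<beta> * t"
    using assms unfolding affine_in_each_def by blast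
  then obtain \<alpha> \<beta> where "\<And>j t. j \<in> A \<Longrightarrow> F j (x(i := t)) = \<alpha> j + \<beta> j * t"
    by metis
  then have "(\<Sum>j\<in>A. c j * F j (x(i := t))) = (\<Sum>j\<in>A. c j * \<alpha> j) + (\<Sum>j\<in>A. c j * \<beta> j) * t" for t
    by (simp add: distrib_left sum.distrib sum_distrib_right mult.assoc)
  then show "\<exists>\<alpha> \<beta>. \<forall>t. (\<Sum>j\<in>A. c j * F j (x(i := t))) = \<alpha> + \<beta> * t"
    by blast
qed

lemma affine_in_each_monomial:
  assumes "distinct js"
  shows "affine_in_each (\<lambda>x. \<Prod>j\<leftarrow>js. x j)"
  unfolding affine_in_each_def
proof (intro allI)
  fix x :: "'a \<Rightarrow> real" and i
  show "\<exists>\<alpha> \<beta>. \<forall>t. (\<Prod>j\<leftarrow>js. (x(i := t)) j) = \<alpha> + \<beta> * t"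
  proof (cases "i \<in> set js")
    case True
    then obtain us vs where js: "js = us @ i # vs"
      by (meson split_list)
    with assms have "map (x(i := t)) us = map x us" "map (x(i := t)) vs = map x vs" for t
      by auto
    then have "\<forall>t. (\<Prod>j\<leftarrow>js. (x(i := t)) j) = 0 + ((\<Prod>j\<leftarrow>us. x j) * (\<Prod>j\<leftarrow>vs. x j)) * t"
      by (simp add: js del: fun_upd_apply map_eq_conv add: fun_upd_same)
    then show ?thesis by blast
  next
    case False
    then have "map (x(i := t)) js = map x js" for t
      by auto
    then have "\<forall>t. (\<Prod>j\<leftarrow>js. (x(i := t)) j) = (\<Prod>j\<leftarrow>js. x j) + 0 * t"
      by (simp del: fun_upd_apply map_eq_conv)
    then show ?thesis by blast
  qed
qed

lemma abs_affine_le_endpoint: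
  fixes \<alpha> \<beta> t l u :: real
  assumes "l \<le> t" "t \<le> u"
  shows "\<exists>s\<in>{l, u}. \<bar>\<alpha> + \<beta> * t\<bar> \<le> \<bar>\<alpha> + \<beta> * s\<bar>"
proof -
  have "min (\<beta> * l) (\<beta> * u) \<le> \<beta> * t \<and> \<beta> * t \<le> max (\<beta> * l) (\<beta> * u)"
    using assms by (cases "\<beta> \<ge> 0") (auto simp: min_le_iff_disj le_max_iff_disj intro: mult_left_mono mult_left_mono_neg)
  then show ?thesis by auto
qed

text \<open>The coordinates in \<open>S\<close> can be pushed one at a time to an end of their interval.\<close>

lemma affine_in_each_le_vertex:
  assumes "affine_in_each F" "finite S" "\<And>i. i \<in> S \<Longrightarrow> x i \<in> {l..u}"
  obtains y where "\<And>i. i \<in> S \<Longrightarrow> y i \<in> {l, u}" "\<And>i. i \<notin> S \<Longrightarrow> y i = x i" "\<bar>F x\<bar> \<le> \<bar>F y\<bar>"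
proof -
  have "\<exists>y. (\<forall>i\<in>S. y i \<in> {l, u}) \<and> (\<forall>i. i \<notin> S \<longrightarrow> y i = x i) \<and> \<bar>F x\<bar> \<le> \<bar>F y\<bar>"
    using assms(2,3)
  proof (induction S)
    case empty
    then show ?case by auto
  next
    case (insert j S)
    then obtain y where y: "\<forall>i\<in>S. y i \<in> {l, u}" "\<forall>i. i \<notin> S \<longrightarrow> y i = x i" "\<bar>F x\<bar> \<le> \<bar>F y\<bar>"
      by auto
    obtain \<alpha> \<beta> where ab: "\<And>t. F (y(j := t)) = \<alpha> + \<beta> * t"
      using assms(1) unfolding affine_in_each_def by blast
    have "l \<le> y j" "y j \<le> u"
      using y(2) insert.hyps insert.prems by auto
    then obtain s where s: "s \<in> {l, u}" "\<bar>\<alpha> + \<beta> * y j\<bar> \<le> \<bar>\<alpha> + \<beta> * s\<bar>"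
      using abs_affine_le_endpoint by blast
    then have "\<bar>F y\<bar> \<le> \<bar>F (y(j := s))\<bar>"
      using ab[of "y j"] ab[of s] by simp
    with y s(1) insert.hyps have "(\<forall>i\<in>insert j S. (y(j := s)) i \<in> {l, u}) \<and>
        (\<forall>i. i \<notin> insert j S \<longrightarrow> (y(j := s)) i = x i) \<and> \<bar>F x\<bar> \<le> \<bar>F (y(j := s))\<bar>"
      by auto
    then show ?case by blast
  qed
  then show thesis using that by blast
qed

section \<open>The form of an array\<close>

definition array_form :: "nat \<Rightarrow> nat \<Rightarrow> (nat list \<Rightarrow> real) \<Rightarrow> (nat \<Rightarrow> real) \<Rightarrow> real" where
  "array_form d n a x = (\<Sum>is\<in>incr_tuples d {1..n}. a is * (\<Prod>i\<leftarrow>is. x i))"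

lemma rademacher_chaos_eq_form:
  "rademacher_chaos d n a t = array_form d n a (\<lambda>i. rademacher i t)"
  by (simp add: rademacher_chaos_def array_form_def)

lemma finite_incr_tuples: "finite I \<Longrightarrow> finite (incr_tuples d I)"
  by (rule finite_subset[OF _ finite_lists_length_eq[of I d]]) (auto simp: incr_tuples_def)

lemma affine_in_each_form: "affine_in_each (array_form d n a)"
  unfolding array_form_def
  by (intro affine_in_each_sum affine_in_each_monomial)
     (auto simp: incr_tuples_def strict_sorted_iff)

lemma array_form_cong:
  assumes "\<And>i. i \<in> {1..n} \<Longrightarrow> x i = y i"
  shows "array_form d n a x = array_form d n a y"
proof -
  have "map x is = map y is" if "is \<in> incr_tuples d {1..n}" for "is"
    using that assms by (auto simp: incr_tuples_def)
  then show ?thesis unfolding array_form_def by (metis (no_types, lifting) sum.cong)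
qed

lemma array_form_scaled_indicator:
  assumes "I \<subseteq> {1..n}"
  shows "array_form d n a (\<lambda>i. if i \<in> I then B else 0) = B ^ d * (\<Sum>is\<in>incr_tuples d I. a is)"
proof -
  let ?x = "\<lambda>i. if i \<in> I then B else (0::real)"
  have in_I: "(\<Prod>i\<leftarrow>is. ?x i) = B ^ d" if "is \<in> incr_tuples d I" for "is"
  proof -
    have "map ?x is = replicate (length is) B"
      using that by (auto simp: incr_tuples_def map_replicate_const[symmetric])
    then show ?thesis using that by (simp add: incr_tuples_def)
  qed
  have "(\<Prod>i\<leftarrow>is. ?x i) = 0" if "is \<in> incr_tuples d {1..n} - incr_tuples d I" for "is"
    using that by (auto simp: incr_tuples_def prod_list_zero_iff)
  then have "array_form d n a ?x = (\<Sum>is\<in>incr_tuples d I. a is * (\<Prod>i\<leftarrow>is. ?x i))"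
    unfolding array_form_def using assms
    by (intro sum.mono_neutral_right) (auto simp: finite_incr_tuples, auto simp: incr_tuples_def)
  also have "\<dots> = B ^ d * (\<Sum>is\<in>incr_tuples d I. a is)"
    by (simp add: in_I sum_distrib_left mult.commute)
  finally show ?thesis .
qed

lemma array_form_along_line_is_poly:
  obtains q :: "real poly"
  where "degree q \<le> d"
    and "\<And>s. poly q s = array_form d n a (\<lambda>i. if i \<in> I then 1 else s)"
proof
  let ?f = "\<lambda>i. if i \<in> I then 1 else [:0, 1:] :: real poly"
  let ?q = "\<Sum>is\<in>incr_tuples d {1..n}. smult (a is) (\<Prod>i\<leftarrow>is. ?f i)"
  have deg: "degree (\<Prod>i\<leftarrow>is. ?f i) \<le> length is" for "is"
  proof (induction "is")
    case (Cons i "is")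
    have "degree (\<Prod>i\<leftarrow>i # is. ?f i) \<le> degree (?f i) + degree (\<Prod>i\<leftarrow>is. ?f i)"
      by (simp only: list.map prod_list.Cons degree_mult_le)
    also have "\<dots> \<le> 1 + length is"
      using Cons by (intro add_mono) auto
    finally show ?case by simp
  qed simp
  show "degree ?q \<le> d"
    by (intro degree_sum_le finite_incr_tuples order.trans[OF degree_smult_le] order.trans[OF deg])
       (auto simp: incr_tuples_def)
  have "poly (\<Prod>i\<leftarrow>is. ?f i) s = (\<Prod>i\<leftarrow>is. if i \<in> I then 1 else s)" for "is" s
    by (induction "is") auto
  then show "poly ?q s = array_form d n a (\<lambda>i. if i \<in> I then 1 else s)" for s
    by (simp add: array_form_def poly_sum)
qed

section \<open>The modified cut norm\<close>

lemma cut_norm_star_eq: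
  "cut_norm_star d n a = Max ((\<lambda>I. \<bar>\<Sum>is\<in>incr_tuples d I. a is\<bar>) ` Pow {1..n})"
  unfolding cut_norm_star_def by (rule arg_cong[of _ _ Max]) auto

lemma abs_sum_le_cut_norm_star:
  assumes "I \<subseteq> {1..n}"
  shows "\<bar>\<Sum>is\<in>incr_tuples d I. a is\<bar> \<le> cut_norm_star d n a"
  unfolding cut_norm_star_eq using assms by (intro Max_ge) auto

lemma cut_norm_star_attained:
  obtains I where "I \<subseteq> {1..n}" "cut_norm_star d n a = \<bar>\<Sum>is\<in>incr_tuples d I. a is\<bar>"
proof -
  have "cut_norm_star d n a \<in> (\<lambda>I. \<bar>\<Sum>is\<in>incr_tuples d I. a is\<bar>) ` Pow {1..n}"
    unfolding cut_norm_star_eq by (intro Max_in) auto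
  then show thesis using that by auto
qed

lemma cut_norm_star_nonneg: "0 \<le> cut_norm_star d n a"
  by (rule order.trans[OF abs_ge_zero abs_sum_le_cut_norm_star[of "{}"]]) simp

text \<open>A vertex of the box is \<open>B\<close> times an indicator, so homogeneity applies there.\<close>

lemma abs_form_le_cut_norm_star:
  assumes "\<And>i. i \<in> {1..n} \<Longrightarrow> x i \<in> {0..B}" and "0 \<le> B"
  shows "\<bar>array_form d n a x\<bar> \<le> B ^ d * cut_norm_star d n a"
proof -
  obtain y where y: "\<And>i. i \<in> {1..n} \<Longrightarrow> y i \<in> {0, B}"
      "\<bar>array_form d n a x\<bar> \<le> \<bar>array_form d n a y\<bar>"
    using affine_in_each_le_vertex[OF affine_in_each_form, of "{1..n}" x 0 B] assms(1)
    by (metis finite_atLeastAtMost)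
  define I where "I = {i \<in> {1..n}. y i = B}"
  have "array_form d n a y = array_form d n a (\<lambda>i. if i \<in> I then B else 0)"
    using y(1) by (intro array_form_cong) (auto simp: I_def)
  also have "\<dots> = B ^ d * (\<Sum>is\<in>incr_tuples d I. a is)"
    by (rule array_form_scaled_indicator) (auto simp: I_def)
  finally have "\<bar>array_form d n a y\<bar> = B ^ d * \<bar>\<Sum>is\<in>incr_tuples d I. a is\<bar>"
    using assms(2) by (simp add: abs_mult)
  also have "\<dots> \<le> B ^ d * cut_norm_star d n a"
    using assms(2) by (intro mult_left_mono abs_sum_le_cut_norm_star) (auto simp: I_def)
  finally show ?thesis using y(2) by linarith
qed

lemma abs_form_signs_le_cut_norm_star:
  assumes "\<And>i. i \<in> {1..n} \<Longrightarrow> \<epsilon> i \<in> {-1, 1}"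
  shows "\<bar>array_form d n a \<epsilon>\<bar> \<le> 2 ^ Suc d * real (Suc d) ^ d * cut_norm_star d n a"
proof -
  let ?K = "real (Suc d) ^ d * cut_norm_star d n a"
  obtain q :: "real poly" where q: "degree q \<le> d"
      "\<And>s. poly q s = array_form d n a (\<lambda>i. if i \<in> {i. \<epsilon> i = 1} then 1 else s)"
    using array_form_along_line_is_poly by blast
  have "\<bar>poly q (real k)\<bar> \<le> ?K" if "k \<le> d" for k
    unfolding q(2) using that by (intro abs_form_le_cut_norm_star) auto
  then have "\<bar>poly q (-1)\<bar> \<le> (2 ^ Suc d - 1) * ?K"
    by (rule poly_extrapolate_minus_one[OF q(1)])
  also have "\<dots> \<le> 2 ^ Suc d * ?K"
    by (intro mult_right_mono) (auto simp: cut_norm_star_nonneg)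
  also have "poly q (-1) = array_form d n a \<epsilon>"
    unfolding q(2)
  proof (rule array_form_cong)
    fix i assume "i \<in> {1..n}"
    from assms[OF this] show "(if i \<in> {i. \<epsilon> i = 1} then 1 else -1) = \<epsilon> i"
      by auto
  qed
  finally show ?thesis by (simp add: mult.assoc)
qed

section \<open>Rademacher functions and the essential supremum\<close>

lemma rademacher_signs: "rademacher i t \<in> {-1, 1}"
  by (simp add: rademacher_def power_int_minus_one_minus power_int_def minus_one_power_iff)

text \<open>The interval is halved once for each further sign; the sign on a half is the parity of its
  index.\<close>

lemma sign_pattern_interval:
  assumes "\<And>i. i \<in> {1..n} \<Longrightarrow> \<epsilon> i \<in> {-1, 1 :: real}"
  obtains k :: nat where "k < 2 ^ n"
    "\<And>i t. i \<in> {1..n} \<Longrightarrow> real k \<le> 2 ^ n * t \<Longrightarrow> 2 ^ n * t < real k + 1 \<Longrightarrow> rademacher i t = \<epsilon> i"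
proof -
  have "\<exists>k<2 ^ n. \<forall>i\<in>{1..n}. \<forall>t. real k \<le> 2 ^ n * t \<and> 2 ^ n * t < real k + 1 \<longrightarrow> rademacher i t = \<epsilon> i"
    using assms
  proof (induction n)
    case 0
    then show ?case by auto
  next
    case (Suc n)
    then obtain k where k: "k < 2 ^ n" "\<And>i t. i \<in> {1..n} \<Longrightarrow> real k \<le> 2 ^ n * t \<Longrightarrow>
        2 ^ n * t < real k + 1 \<Longrightarrow> rademacher i t = \<epsilon> i"
      by fastforce
    define b :: nat where "b = (if \<epsilon> (Suc n) = 1 then 0 else 1)"
    define k' where "k' = 2 * k + b"
    have b: "b \<le> 1" by (simp add: b_def)
    have "rademacher i t = \<epsilon> i"
      if i: "i \<in> {1..Suc n}" and t: "real k' \<le> 2 ^ Suc n * t" "2 ^ Suc n * t < real k' + 1" for i t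
    proof (cases "i = Suc n")
      case True
      have "\<lfloor>2 ^ Suc n * t\<rfloor> = int k'"
        using t by (intro floor_unique) auto
      then have "rademacher i t = (-1) ^ k'"
        by (simp add: rademacher_def True del: power_Suc)
      also have "\<dots> = \<epsilon> i"
        using Suc.prems[of "Suc n"] by (auto simp: k'_def b_def True)
      finally show ?thesis .
    next
      case False
      have "2 * real k \<le> 2 * (2 ^ n * t)" "2 * (2 ^ n * t) < 2 * real k + 2"
        using t b by (auto simp: k'_def)
      then show ?thesis
        using k(2)[of i t] i False by auto
    qed
    moreover have "k' < 2 ^ Suc n"
      using k(1) b by (simp add: k'_def)
    ultimately show ?case by blast
  qed
  then show thesis using that by blast
qed

lemma measurable_rademacher [measurable]: "rademacher i \<in> borel_measurable borel"
  unfolding rademacher_def by measurable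

lemma measurable_rademacher_chaos: "rademacher_chaos d n a \<in> borel_measurable borel"
proof -
  have "(\<lambda>t. \<Prod>i\<leftarrow>is. rademacher i t) \<in> borel_measurable borel" for "is"
    by (induction "is") auto
  then show ?thesis
    unfolding rademacher_chaos_def by measurable
qed

lemma measurable_abs_rademacher_chaos:
  "(\<lambda>t. ereal \<bar>rademacher_chaos d n a t\<bar>) \<in> borel_measurable (lebesgue_on S)"
proof -
  have "(\<lambda>t. ereal \<bar>rademacher_chaos d n a t\<bar>) \<in> borel_measurable borel"
    using measurable_rademacher_chaos by measurable
  then show ?thesis
    by (intro measurable_restrict_space1 measurable_completion) simp
qed

lemma Linfty_norm_rademacher_chaos_le:
  assumes "\<And>t. \<bar>rademacher_chaos d n a t\<bar> \<le> C"
  shows "Linfty_norm (rademacher_chaos d n a) \<le> ereal C"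
  unfolding Linfty_norm_def
  using assms by (intro esssup_I measurable_abs_rademacher_chaos) auto

text \<open>The chaos is constant, equal to the value of the form, on an interval of positive length.\<close>

lemma abs_form_le_Linfty_norm:
  assumes "\<And>i. i \<in> {1..n} \<Longrightarrow> \<epsilon> i \<in> {-1, 1}"
  shows "ereal \<bar>array_form d n a \<epsilon>\<bar> \<le> Linfty_norm (rademacher_chaos d n a)"
proof (rule ccontr)
  assume less: "\<not> ?thesis"
  obtain k :: nat where k: "k < 2 ^ n" "\<And>i t. i \<in> {1..n} \<Longrightarrow> real k \<le> 2 ^ n * t \<Longrightarrow>
      2 ^ n * t < real k + 1 \<Longrightarrow> rademacher i t = \<epsilon> i"
    using sign_pattern_interval[of n \<epsilon>] assms by blast
  define l u where "l = real k / 2 ^ n" and "u = (real k + 1) / 2 ^ n"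
  have "l < u"
    by (simp add: l_def u_def divide_strict_right_mono)
  have "real k + 1 \<le> 2 ^ n"
    using k(1) by (metis Suc_leI of_nat_Suc of_nat_le_iff of_nat_numeral of_nat_power add.commute)
  then have "0 \<le> l" "u \<le> 1"
    by (simp_all add: l_def u_def)
  then have "{l..<u} \<subseteq> {0..1}"
    by auto
  have const: "rademacher_chaos d n a t = array_form d n a \<epsilon>" if "t \<in> {l..<u}" for t
    unfolding rademacher_chaos_eq_form
    using that by (intro array_form_cong k(2)) (auto simp: l_def u_def field_simps)
  have "AE t in lebesgue_on {0..1}. ereal \<bar>rademacher_chaos d n a t\<bar> \<le> Linfty_norm (rademacher_chaos d n a)"
    unfolding Linfty_norm_def by (rule esssup_AE)
  then have "AE t in lebesgue_on {0..1}. t \<notin> {l..<u}"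
  proof eventually_elim
    case (elim t)
    then show ?case using const[of t] less by auto
  qed
  then have "AE t in lebesgue. t \<in> {0..1} \<longrightarrow> t \<notin> {l..<u}"
    by (subst (asm) AE_restrict_space_iff) auto
  then have "AE t in lebesgue. t \<notin> {l..<u}"
  proof eventually_elim
    case (elim t)
    then show ?case using \<open>{l..<u} \<subseteq> {0..1}\<close> by blast
  qed
  then have "emeasure lebesgue {l..<u} = 0"
    by (subst (asm) AE_iff_measurable[of "{l..<u}"]) auto
  then show False
    using \<open>l < u\<close> by simp
qed

lemma cut_norm_star_le_Linfty_norm:
  "ereal (cut_norm_star d n a) \<le> Linfty_norm (rademacher_chaos d n a)"
proof -
  obtain I where I: "I \<subseteq> {1..n}" "cut_norm_star d n a = \<bar>\<Sum>is\<in>incr_tuples d I. a is\<bar>"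
    by (rule cut_norm_star_attained)
  let ?x = "\<lambda>i. if i \<in> I then 1 else 0 :: real"
  obtain y where y: "\<And>i. i \<in> {1..n} \<Longrightarrow> y i \<in> {-1, 1}"
      "\<bar>array_form d n a ?x\<bar> \<le> \<bar>array_form d n a y\<bar>"
    by (rule affine_in_each_le_vertex[OF affine_in_each_form, of "{1..n}" ?x "-1" 1]) auto
  have "ereal (cut_norm_star d n a) \<le> ereal \<bar>array_form d n a y\<bar>"
    using y(2) I by (simp add: array_form_scaled_indicator)
  also have "\<dots> \<le> Linfty_norm (rademacher_chaos d n a)"
    by (rule abs_form_le_Linfty_norm[OF y(1)])
  finally show ?thesis .
qed

theorem mainTheorem10:
  fixes d :: nat
  shows "\<exists>c C :: real. 0 < c \<and> c \<le> C \<and>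
    (\<forall>(n :: nat) (a :: nat list \<Rightarrow> real). d \<le> n \<longrightarrow>
      ereal (c * cut_norm_star d n a) \<le> Linfty_norm (rademacher_chaos d n a) \<and>
      Linfty_norm (rademacher_chaos d n a) \<le> ereal (C * cut_norm_star d n a))"
proof -
  let ?C = "2 ^ Suc d * real (Suc d) ^ d"
  have "1 * 1 \<le> ?C"
    by (intro mult_mono one_le_power) auto
  moreover have "Linfty_norm (rademacher_chaos d n a) \<le> ereal (?C * cut_norm_star d n a)" for n a
    by (intro Linfty_norm_rademacher_chaos_le)
       (simp only: rademacher_chaos_eq_form abs_form_signs_le_cut_norm_star rademacher_signs)
  ultimately show ?thesis
    using cut_norm_star_le_Linfty_norm by (intro exI[of _ 1] exI[of _ ?C]) auto
qed

end
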